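(* Let $\tau\in\mathbb{C}$ with $\operatorname{Im}\tau>0$ and let $m$ be a positive integer. Then for all $y,z\in\mathbb{C}$, $$\sum_{k=0}^{2m-1}(-1)^k\theta_3\left(z+y+\frac{k\pi}{2m}\,\Big|\,\tau\right)\theta_3\left(z-y+\frac{k\pi}{2m}\,\Big|\,\tau\right)=\begin{cases}2m\,\theta_2(2y|2\tau)\,\theta_2(2mz|2m^2\tau), & \text{if } m \text{ is odd};\\ 2m\,\theta_3(2y|2\tau)\,\theta_2(2mz|2m^2\tau), & \text{if } m \text{ is even}.\end{cases}$$
   Context: For $\operatorname{Im}\tau>0$ put $q=e^{2\pi i\tau}$, and for real $a$ let $q^a:=e^{2\pi i a\tau}$. The Jacobi theta functions used are, for $z\in\mathbb{C}$, $$\theta_2(z|\tau)=q^{\frac18}\sum_{n=-\infty}^{\infty}q^{\frac{n(n+1)}{2}}e^{(2n+1)iz},\qquad \theta_3(z|\tau)=\sum_{n=-\infty}^{\infty}q^{\frac{n^2}{2}}e^{2niz}.$$ When the second argument is $c\tau$ for a constant $c>0$, $q$ is replaced by $e^{2\pi i c\tau}$ in these definitions. *)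

theory Defs
  imports "HOL-Analysis.Analysis"
begin

text \<open>The real power \<open>q\<^sup>a\<close> of the nome \<open>q = exp (2 \<pi> \<i> \<tau>)\<close>. It is a function of \<open>\<tau>\<close> rather than
  of \<open>q\<close>, which fixes the branch of the power.\<close>

definition qpow :: "complex \<Rightarrow> real \<Rightarrow> complex" where
  "qpow \<tau> a = exp (2 * of_real pi * \<i> * of_real a * \<tau>)"

text \<open>The bilateral series are unconditional sums over the integers; they converge
  absolutely for \<open>Im \<tau> > 0\<close>, the only case of interest.\<close>

definition theta2 :: "complex \<Rightarrow> complex \<Rightarrow> complex" where
  "theta2 z \<tau> = qpow \<tau> (1/8) *
     (\<Sum>\<^sub>\<infinity>n::int. qpow \<tau> (of_int (n * (n + 1)) / 2) * exp (of_int (2 * n + 1) * \<i> * z))"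

definition theta3 :: "complex \<Rightarrow> complex \<Rightarrow> complex" where
  "theta3 z \<tau> =
     (\<Sum>\<^sub>\<infinity>n::int. qpow \<tau> (of_int (n ^ 2) / 2) * exp (2 * of_int n * \<i> * z))"

end

theory Submission
  imports Defs
begin

text \<open>
  Write \<open>G \<tau> z x = exp (\<pi> \<i> \<tau> x\<^sup>2 + 2 \<i> x z)\<close> for the term \<open>gauss_term\<close>; then \<open>\<theta>\<^sub>3\<close> is the sum of
  \<open>G\<close> over the integers and \<open>\<theta>\<^sub>2\<close> is the sum of \<open>G\<close> over the half-integers. Each
  product \<open>\<theta>\<^sub>3 \<cdot> \<theta>\<^sub>3\<close> on the left is thus an absolutely convergent double series over
  \<open>(a, b)\<close> in the lattice \<open>\<int>\<^sup>2\<close>, and the proof rests on three facts about it.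

  \<^item> The shift by \<open>k \<pi> / (2 m)\<close> multiplies the \<open>(a, b)\<close> term by
    \<open>exp (\<pi> \<i> k (a + b) / m)\<close>, and \<open>(-1)\<^sup>k = exp (\<pi> \<i> k)\<close>. The sum over \<open>k\<close> therefore runs over
    the powers of one \<open>2 m\<close>-th root of unity, and it keeps exactly the pairs for which
    \<open>a + b\<close> is an odd multiple of \<open>m\<close>, with weight \<open>2 m\<close>
    (\<open>alternating_theta3_product_has_sum\<close>).
  \<^item> By the parallelogram law \<open>a\<^sup>2 + b\<^sup>2 = ((a + b)\<^sup>2 + (a - b)\<^sup>2) / 2\<close>, each term splits
    into a function of \<open>a + b\<close> and a function of \<open>a - b\<close> (\<open>gauss_term_mult\<close>).
  \<^item> The surviving pairs are given by \<open>a + b = m (2 n + 1)\<close> and \<open>a - b = 2 l + (m mod 2)\<close> with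
    free integers \<open>n\<close> and \<open>l\<close>, because \<open>a + b\<close> and \<open>a - b\<close> have the same parity, namely that
    of \<open>m\<close>. So the double series factors (\<open>alternating_theta3_product_eq\<close>).

  The sum over \<open>n\<close> is the series of \<open>\<theta>\<^sub>2\<close>. The sum over \<open>l\<close> runs over half-integers for odd
  \<open>m\<close> and over integers for even \<open>m\<close>, which is the case distinction in the theorem.
\<close>

section \<open>Absolutely convergent double series\<close>

lemma has_sum_sum:
  fixes f :: "'i \<Rightarrow> 'a \<Rightarrow> 'b :: topological_comm_monoid_add"
  assumes "finite I" and "\<And>i. i \<in> I \<Longrightarrow> (f i has_sum s i) A"
  shows "((\<lambda>x. \<Sum>i\<in>I. f i x) has_sum (\<Sum>i\<in>I. s i)) A"
  using assms by (induction I rule: finite_induct) (auto intro!: has_sum_add)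

text \<open>Absolute convergence of both factors makes the family of all products summable; its sum is
  then computed by rows.\<close>

lemma has_sum_mult_Times:
  fixes f :: "'a \<Rightarrow> complex" and g :: "'b \<Rightarrow> complex"
  assumes "(\<lambda>x. norm (f x)) summable_on A" and "(\<lambda>y. norm (g y)) summable_on B"
  shows "((\<lambda>(x, y). f x * g y) has_sum (infsum f A * infsum g B)) (A \<times> B)"
proof (rule has_sum_SigmaI)
  have f: "f summable_on A" and g: "g summable_on B"
    using assms by (auto intro: Infinite_Sum.abs_summable_summable)
  show "((\<lambda>y. case (x, y) of (x, y) \<Rightarrow> f x * g y) has_sum (f x * infsum g B)) B" for x
    using has_sum_cmult_right[OF has_sum_infsum[OF g], of "f x"] by simp
  show "((\<lambda>x. f x * infsum g B) has_sum (infsum f A * infsum g B)) A"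
    using has_sum_cmult_left[OF has_sum_infsum[OF f]] .
  have "(\<lambda>p. norm (case p of (x, y) \<Rightarrow> f x * g y)) summable_on A \<times> B"
    unfolding Infinite_Sum.abs_summable_on_Sigma_iff
    using assms
    by (auto simp: norm_mult infsum_cmult_right' abs_mult
             intro!: summable_on_cmult_right summable_on_cmult_left)
  thus "(\<lambda>(x, y). f x * g y) summable_on A \<times> B"
    by (rule Infinite_Sum.abs_summable_summable)
qed

section \<open>Theta series as Gaussian sums over shifted integers\<close>

text \<open>The general term of the theta functions with characteristics. The variable \<open>x\<close> is real, so
  that integer and half-integer summation points are treated together.\<close>

definition gauss_term :: "complex \<Rightarrow> complex \<Rightarrow> real \<Rightarrow> complex" where
  "gauss_term \<tau> z x = exp (\<i> * of_real pi * \<tau> * of_real x ^ 2 + 2 * \<i> * of_real x * z)"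

lemma theta3_eq_infsum_gauss:
  "theta3 z \<tau> = (\<Sum>\<^sub>\<infinity>n::int. gauss_term \<tau> z (of_int n))"
  unfolding theta3_def qpow_def gauss_term_def
  by (intro infsum_cong) (simp add: exp_add [symmetric] algebra_simps)

text \<open>Completing the square: \<open>n (n + 1) / 2 + 1 / 8 = (n + 1 / 2)\<^sup>2 / 2\<close>. The prefactor of \<open>\<theta>\<^sub>2\<close>
  supplies the \<open>1 / 8\<close>.\<close>

lemma theta2_eq_infsum_gauss:
  "theta2 z \<tau> = (\<Sum>\<^sub>\<infinity>n::int. gauss_term \<tau> z (of_int n + 1 / 2))"
proof -
  have "qpow \<tau> (1/8) * (qpow \<tau> (of_int (n * (n + 1)) / 2) * exp (of_int (2 * n + 1) * \<i> * z))
        = gauss_term \<tau> z (of_int n + 1 / 2)" for n :: int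
    unfolding qpow_def gauss_term_def exp_add [symmetric]
    by (rule arg_cong[of _ _ exp]) (simp add: algebra_simps power2_eq_square)
  thus ?thesis
    unfolding theta2_def by (simp add: infsum_cmult_right' [symmetric])
qed

lemma summable_on_exp_minus_abs_int: "(\<lambda>n::int. exp (- \<bar>of_int n :: real\<bar>)) summable_on UNIV"
proof -
  have "summable (\<lambda>n. exp (-1 :: real) ^ n)"
    by (rule summable_geometric) simp
  hence nat: "(\<lambda>n. exp (- real n)) summable_on UNIV"
    by (intro summable_nonneg_imp_summable_on) (simp_all add: exp_of_nat_mult [symmetric])
  have inj: "inj int" "inj (\<lambda>n. - int n)"
    by (simp_all add: inj_on_def)
  have pos: "(\<lambda>n::int. exp (- \<bar>of_int n :: real\<bar>)) summable_on range int"
    unfolding summable_on_reindex[OF inj(1)] o_def using nat by simp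
  have neg: "(\<lambda>n::int. exp (- \<bar>of_int n :: real\<bar>)) summable_on range (\<lambda>n. - int n)"
    unfolding summable_on_reindex[OF inj(2)] o_def using nat by simp
  have "range int \<union> range (\<lambda>n. - int n) = UNIV"
  proof (rule UNIV_eq_I [symmetric])
    show "i \<in> range int \<union> range (\<lambda>n. - int n)" for i
      by (cases i rule: int_cases2) auto
  qed
  thus ?thesis
    using summable_on_union[OF pos neg] by simp
qed

text \<open>The modulus of a term is the exponential of a quadratic with leading coefficient
  \<open>- \<pi> Im \<tau> < 0\<close>, and such a quadratic plus \<open>\<bar>n\<bar>\<close> is bounded above. So the terms decay
  at least like \<open>exp (- \<bar>n\<bar>)\<close>.\<close>

lemma gauss_term_abs_summable:
  assumes "Im \<tau> > 0"
  shows "(\<lambda>n::int. norm (gauss_term \<tau> z (of_int n + c))) summable_on UNIV"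
proof -
  define a b where "a = pi * Im \<tau>" and "b = 2 * \<bar>Im z\<bar> + 1"
  \<comment> \<open>\<open>b\<^sup>2 / (4 a)\<close> is the maximum of \<open>- a u\<^sup>2 + b u\<close>; the \<open>+ 1\<close> in \<open>b\<close> pays for the factor
      \<open>exp (- \<bar>n\<bar>)\<close>, and \<open>\<bar>c\<bar>\<close> for the distance from \<open>n\<close> to \<open>n + c\<close>.\<close>
  define C where "C = b\<^sup>2 / (4 * a) + \<bar>c\<bar>"
  have a: "a > 0" using assms by (simp add: a_def)
  have "norm (gauss_term \<tau> z (of_int n + c)) \<le> exp C * exp (- \<bar>of_int n :: real\<bar>)" for n :: int
  proof -
    define x where "x = of_int n + c"
    have "norm (gauss_term \<tau> z x) = exp (- a * x\<^sup>2 - 2 * x * Im z)"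
      by (simp add: gauss_term_def a_def algebra_simps flip: of_real_power)
    moreover have "- (2 * x * Im z) \<le> 2 * \<bar>x\<bar> * \<bar>Im z\<bar>"
      using abs_ge_minus_self[of "2 * x * Im z"] by (simp add: abs_mult)
    moreover have "- a * x\<^sup>2 + b * \<bar>x\<bar> \<le> b\<^sup>2 / (4 * a)"
    proof -
      have "0 \<le> (2 * a * \<bar>x\<bar> - b)\<^sup>2" by simp
      also have "\<dots> = 4 * a * (a * x\<^sup>2 - b * \<bar>x\<bar>) + b\<^sup>2"
        by (simp add: power2_diff power_mult_distrib) (simp add: algebra_simps power2_eq_square)
      finally show ?thesis using a by (simp add: field_simps)
    qed
    moreover have "\<bar>of_int n\<bar> \<le> \<bar>x\<bar> + \<bar>c\<bar>"
      unfolding x_def by linarith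
    ultimately show ?thesis
      by (simp add: x_def [symmetric] C_def b_def flip: exp_add) (simp add: algebra_simps)
  qed
  thus ?thesis
    by (rule Infinite_Sum.abs_summable_on_comparison_test'[rotated])
       (intro summable_on_cmult_right summable_on_exp_minus_abs_int)
qed

text \<open>The parallelogram law in the quadratic part, and
  \<open>a (z + y) + b (z - y) = (a + b) z + (a - b) y\<close> in the linear part.\<close>

lemma gauss_term_mult:
  "gauss_term \<tau> (z + y) a * gauss_term \<tau> (z - y) b =
     gauss_term (2 * \<tau>) (2 * z) ((a + b) / 2) * gauss_term (2 * \<tau>) (2 * y) ((a - b) / 2)"
  unfolding gauss_term_def exp_add [symmetric]
  by (rule arg_cong[of _ _ exp]) (simp add: field_simps power2_eq_square)

text \<open>The scaling that produces the arguments \<open>2 m z\<close> and \<open>2 m\<^sup>2 \<tau>\<close>: if \<open>a + b\<close> is an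
  odd multiple of \<open>m\<close>, then \<open>(a + b) / 2 = m x\<close> for a half-integer \<open>x\<close>.\<close>

lemma gauss_term_scale:
  "gauss_term (2 * of_nat m ^ 2 * \<tau>) (2 * of_nat m * z) x = gauss_term (2 * \<tau>) (2 * z) (of_nat m * x)"
  unfolding gauss_term_def by (simp add: field_simps power2_eq_square)

lemma gauss_term_shift:
  "gauss_term \<tau> (z + w) x = exp (2 * \<i> * of_real x * w) * gauss_term \<tau> z x"
  unfolding gauss_term_def by (simp add: field_simps flip: exp_add)

section \<open>Averaging over the shifts\<close>

text \<open>The sign \<open>(-1)\<^sup>k\<close> turns \<open>s\<close> into \<open>s + m\<close> in the exponent, so this is the geometric sum of
  \<open>w = exp (\<pi> \<i> (s + m) / m)\<close>, a root of unity of order dividing \<open>2 m\<close>.\<close>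

lemma sum_alternating_roots_of_unity:
  fixes s :: int and m :: nat
  assumes "m > 0"
  shows "(\<Sum>k = 0..2 * m - 1. (-1) ^ k * exp (\<i> * of_real pi * of_nat k * of_int s / of_nat m))
         = (if 2 * int m dvd s + int m then 2 * of_nat m else (0 :: complex))"
proof -
  define w where "w = exp (\<i> * of_real pi * of_int (s + int m) / of_nat m)"
  have w: "w = - exp (\<i> * of_real pi * of_int s / of_nat m)"
  proof -
    have "\<i> * of_real pi * of_int (s + int m) / of_nat m
          = \<i> * of_real pi * of_int s / of_nat m + \<i> * (of_real pi :: complex)"
      using assms by (simp add: field_simps)
    thus ?thesis unfolding w_def by (simp only: exp_add exp_pi_i') simp
  qed
  have "(\<Sum>k = 0..2 * m - 1. (-1) ^ k * exp (\<i> * of_real pi * of_nat k * of_int s / of_nat m))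
        = (\<Sum>k<2 * m. w ^ k)"
  proof (rule sum.cong)
    show "{0..2 * m - 1} = {..<2 * m}" using assms by auto
    show "(-1) ^ k * exp (\<i> * of_real pi * of_nat k * of_int s / of_nat m) = w ^ k" for k
      unfolding w power_minus[of "exp _"] exp_of_nat_mult [symmetric]
      by (simp add: algebra_simps)
  qed
  moreover have "w ^ (2 * m) = 1"
  proof -
    have "w ^ (2 * m) = exp (of_nat (2 * m) * (\<i> * of_real pi * of_int (s + int m) / of_nat m))"
      unfolding w_def exp_of_nat_mult ..
    also have "of_nat (2 * m) * (\<i> * of_real pi * of_int (s + int m) / of_nat m)
               = 2 * of_int (s + int m) * of_real pi * \<i>"
      using assms by (simp add: field_simps)
    finally show ?thesis
      using exp_integer_2pi[of "of_int (s + int m)"] by (simp add: mult_ac)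
  qed
  moreover have "w = 1 \<longleftrightarrow> 2 * int m dvd s + int m"
  proof -
    have "w = 1 \<longleftrightarrow> (\<exists>n::int. pi * of_int (s + int m) / of_nat m = of_int (2 * n) * pi)"
      by (simp add: w_def exp_eq_1)
    also have "\<dots> \<longleftrightarrow> (\<exists>n::int. real_of_int (s + int m) = real_of_int (2 * int m * n))"
    proof (intro arg_cong[of _ _ Ex] ext)
      fix n :: int
      have "pi * of_int (s + int m) / of_nat m = of_int (2 * n) * pi
            \<longleftrightarrow> pi * of_int (s + int m) = pi * of_int (2 * int m * n)"
        using assms by (simp add: field_simps)
      thus "pi * of_int (s + int m) / of_nat m = of_int (2 * n) * pi
            \<longleftrightarrow> real_of_int (s + int m) = of_int (2 * int m * n)"
        unfolding mult_cancel_left by simp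
    qed
    also have "\<dots> \<longleftrightarrow> 2 * int m dvd s + int m"
      unfolding of_int_eq_iff dvd_def ..
    finally show ?thesis .
  qed
  ultimately show ?thesis
    by (simp add: sum_gp_strict)
qed

text \<open>The finite sum over \<open>k\<close> is moved inside the double series, where it becomes the indicator
  function of a congruence on \<open>a + b\<close>.\<close>

lemma alternating_theta3_product_has_sum:
  fixes \<tau> y z :: complex and m :: nat
  assumes "Im \<tau> > 0" and "m > 0"
  shows "((\<lambda>(a, b). 2 * of_nat m
             * (gauss_term \<tau> (z + y) (of_int a) * gauss_term \<tau> (z - y) (of_int b))) has_sum
         (\<Sum>k = 0..2 * m - 1. (-1) ^ k
            * theta3 (z + y + of_nat k * of_real pi / (2 * of_nat m)) \<tau>
            * theta3 (z - y + of_nat k * of_real pi / (2 * of_nat m)) \<tau>))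
         {(a, b). 2 * int m dvd a + b + int m}"
    (is "(?F has_sum ?S) ?A")
proof -
  define w :: "nat \<Rightarrow> complex" where "w k = of_nat k * of_real pi / (2 * of_nat m)" for k
  define f where "f k a b = (-1) ^ k * (gauss_term \<tau> (z + y + w k) (of_int a)
                     * gauss_term \<tau> (z - y + w k) (of_int b))" for k :: nat and a b :: int
  note sm = gauss_term_abs_summable[OF assms(1), of _ 0, simplified]
  have "((\<lambda>(a, b). f k a b) has_sum
          ((-1) ^ k * (theta3 (z + y + w k) \<tau> * theta3 (z - y + w k) \<tau>))) UNIV" for k
    using has_sum_cmult_right[OF has_sum_mult_Times[OF sm sm], of "(-1) ^ k"]
    unfolding f_def theta3_eq_infsum_gauss by (simp add: case_prod_unfold)
  hence "((\<lambda>p. \<Sum>k = 0..2 * m - 1. case p of (a, b) \<Rightarrow> f k a b) has_sum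
          (\<Sum>k = 0..2 * m - 1. (-1) ^ k * (theta3 (z + y + w k) \<tau> * theta3 (z - y + w k) \<tau>))) UNIV"
    by (intro has_sum_sum) auto
  also have "(\<Sum>k = 0..2 * m - 1. (-1) ^ k * (theta3 (z + y + w k) \<tau> * theta3 (z - y + w k) \<tau>)) = ?S"
    by (simp add: w_def mult.assoc)
  also have "((\<lambda>p. \<Sum>k = 0..2 * m - 1. case p of (a, b) \<Rightarrow> f k a b) has_sum ?S) UNIV
             \<longleftrightarrow> (?F has_sum ?S) ?A"
  proof -
    have "(\<Sum>k = 0..2 * m - 1. f k a b) = (if (a, b) \<in> ?A then ?F (a, b) else 0)" for a b
    proof -
      have "f k a b = (-1) ^ k * exp (\<i> * of_real pi * of_nat k * of_int (a + b) / of_nat m)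
              * (gauss_term \<tau> (z + y) (of_int a) * gauss_term \<tau> (z - y) (of_int b))" for k
      proof -
        have "exp (2 * \<i> * of_real (of_int a) * w k) * exp (2 * \<i> * of_real (of_int b) * w k)
              = exp (\<i> * of_real pi * of_nat k * of_int (a + b) / of_nat m)"
          using assms(2) unfolding w_def exp_add [symmetric]
          by (intro arg_cong[of _ _ exp]) (simp add: field_simps)
        thus ?thesis
          unfolding f_def gauss_term_shift by (simp add: mult_ac)
      qed
      thus ?thesis
        using sum_alternating_roots_of_unity[OF assms(2), of "a + b"]
        by (simp add: sum_distrib_right [symmetric] del: of_int_add)
    qed
    thus ?thesis
      by (intro has_sum_cong_neutral) auto
  qed
  finally show ?thesis .
qed

section \<open>Separation into a sum series and a difference series\<close>

text \<open>Both parities of \<open>m\<close> at once: on the index set left by the averaging, half the sum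
  \<open>a + b\<close> and half the difference \<open>a - b\<close> range independently over \<open>m (\<int> + 1 / 2)\<close> and
  \<open>\<int> + (m mod 2) / 2\<close>.\<close>

lemma alternating_theta3_product_eq:
  fixes \<tau> y z :: complex and m :: nat
  assumes "Im \<tau> > 0" and "m > 0"
  shows "(\<Sum>k = 0..2 * m - 1. (-1) ^ k
            * theta3 (z + y + of_nat k * of_real pi / (2 * of_nat m)) \<tau>
            * theta3 (z - y + of_nat k * of_real pi / (2 * of_nat m)) \<tau>)
         = 2 * of_nat m * theta2 (2 * of_nat m * z) (2 * of_nat m ^ 2 * \<tau>)
             * (\<Sum>\<^sub>\<infinity>l::int. gauss_term (2 * \<tau>) (2 * y) (of_int l + of_nat (m mod 2) / 2))"
    (is "?S = ?R")
proof -
  define h e where "h = int m div 2" and "e = int m mod 2"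
  have m: "int m = 2 * h + e" by (auto simp: h_def e_def)
  \<comment> \<open>The solution \<open>(a, b)\<close> of \<open>a + b = m (2 n + 1)\<close> and \<open>a - b = 2 l + e\<close>; it is integral
      because \<open>(m + e) / 2 = h + e\<close> and \<open>(m - e) / 2 = h\<close>.\<close>
  define j where "j = (\<lambda>(n, l). (int m * n + l + h + e, int m * n - l + h))"
  define A where "A = {(a, b). 2 * int m dvd a + b + int m}"
  have "bij_betw j UNIV A"
  proof (rule bij_betw_imageI)
    show "inj j"
    proof (rule injI, clarify)
      fix n l n' l' assume "j (n, l) = j (n', l')"
      hence "int m * n + l = int m * n' + l'" "int m * n - l = int m * n' - l'"
        by (simp_all add: j_def)
      hence "int m * n = int m * n'" and "l = l'" by linarith+
      thus "n = n' \<and> l = l'" using assms(2) by simp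
    qed
    show "range j = A"
    proof (intro equalityI subsetI)
      fix p assume "p \<in> range j"
      then obtain n l where "p = j (n, l)" by auto
      moreover have "2 * int m * n + 2 * h + e + int m = 2 * int m * (n + 1)"
        by (simp add: m algebra_simps)
      ultimately show "p \<in> A"
        by (auto simp: A_def j_def algebra_simps intro!: dvdI[of _ _ "n + 1"])
    next
      fix p assume "p \<in> A"
      then obtain a b t where p: "p = (a, b)" and t: "a + b + int m = 2 * int m * t"
        by (auto simp: A_def dvd_def)
      have "p = j (t - 1, a - int m * (t - 1) - h - e)"
        using t m by (simp add: p j_def algebra_simps)
      thus "p \<in> range j" by blast
    qed
  qed
  moreover have "2 * of_nat m * (gauss_term \<tau> (z + y) (of_int a) * gauss_term \<tau> (z - y) (of_int b))
      = 2 * of_nat m * (gauss_term (2 * of_nat m ^ 2 * \<tau>) (2 * of_nat m * z) (of_int n + 1 / 2)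
            * gauss_term (2 * \<tau>) (2 * y) (of_int l + of_nat (m mod 2) / 2))"
    if "j (n, l) = (a, b)" for n l a b
  proof -
    have "real m = of_int (int m)" by simp
    hence m': "real m = 2 * of_int h + of_int e" unfolding m by simp
    have e': "real (m mod 2) = of_int e"
      unfolding e_def by (metis of_int_of_nat_eq of_nat_numeral zmod_int)
    have "of_int a = real m * of_int n + of_int l + of_int h + of_int e"
         "of_int b = real m * of_int n - of_int l + of_int h"
      using that by (auto simp: j_def)
    hence "(of_int a + of_int b) / 2 = real m * (of_int n + 1 / 2)"
         "(of_int a - of_int b) / 2 = of_int l + real (m mod 2) / 2"
      by (simp_all add: m' e' field_simps)
    thus ?thesis by (simp only: gauss_term_mult gauss_term_scale)
  qed
  ultimately have "((\<lambda>(n, l). 2 * of_nat m *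
       (gauss_term (2 * of_nat m ^ 2 * \<tau>) (2 * of_nat m * z) (of_int n + 1 / 2)
          * gauss_term (2 * \<tau>) (2 * y) (of_int l + of_nat (m mod 2) / 2))) has_sum ?S) UNIV"
    using alternating_theta3_product_has_sum[OF assms, of z y]
    unfolding A_def [symmetric]
    by (subst (asm) has_sum_reindex_bij_betw[symmetric, of j UNIV A])
       (auto elim!: has_sum_cong[THEN iffD1, rotated] split: prod.splits)
  moreover have "((\<lambda>(n, l). 2 * of_nat m *
       (gauss_term (2 * of_nat m ^ 2 * \<tau>) (2 * of_nat m * z) (of_int n + 1 / 2)
          * gauss_term (2 * \<tau>) (2 * y) (of_int l + of_nat (m mod 2) / 2))) has_sum ?R) UNIV"
  proof -
    have "2 * of_nat m ^ 2 * \<tau> = of_real (2 * real m ^ 2) * \<tau>"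
      by simp
    hence "Im (2 * of_nat m ^ 2 * \<tau>) = 2 * real m ^ 2 * Im \<tau>"
      by (simp only: times_complex.simps Re_complex_of_real Im_complex_of_real)
    hence pos: "Im (2 * of_nat m ^ 2 * \<tau>) > 0" "Im (2 * \<tau>) > 0"
      using assms by simp_all
    show ?thesis
      using has_sum_cmult_right[OF has_sum_mult_Times[OF
          gauss_term_abs_summable[OF pos(1), of "2 * of_nat m * z" "1/2"]
          gauss_term_abs_summable[OF pos(2), of "2 * y" "of_nat (m mod 2) / 2"]], of "2 * of_nat m"]
      unfolding theta2_eq_infsum_gauss by (simp add: case_prod_unfold mult.assoc)
  qed
  ultimately show ?thesis by (rule has_sum_unique)
qed

theorem corollary1p9:
  fixes \<tau> y z :: complex and m :: nat
  assumes "Im \<tau> > 0" and "m > 0"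
  shows "(\<Sum>k = 0..2 * m - 1. (-1) ^ k
            * theta3 (z + y + of_nat k * of_real pi / (2 * of_nat m)) \<tau>
            * theta3 (z - y + of_nat k * of_real pi / (2 * of_nat m)) \<tau>)
         = (if odd m
            then 2 * of_nat m * theta2 (2 * y) (2 * \<tau>)
                   * theta2 (2 * of_nat m * z) (2 * of_nat m ^ 2 * \<tau>)
            else 2 * of_nat m * theta3 (2 * y) (2 * \<tau>)
                   * theta2 (2 * of_nat m * z) (2 * of_nat m ^ 2 * \<tau>))"
proof (cases "odd m")
  case True
  hence "real (m mod 2) / 2 = 1 / 2" by (simp add: odd_iff_mod_2_eq_one)
  thus ?thesis
    using True unfolding alternating_theta3_product_eq[OF assms]
    by (simp add: theta2_eq_infsum_gauss[of "2 * y"])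
next
  case False
  hence "real (m mod 2) / 2 = 0" by simp
  thus ?thesis
    using False unfolding alternating_theta3_product_eq[OF assms]
    by (simp add: theta3_eq_infsum_gauss[of "2 * y"])
qed

end
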